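(* Let $\lambda_0\in(0,\infty]$, let $\phi_1,\phi_2,\ldots\in\Phi$ be functions on $(-\lambda_0,\lambda_0)$, and let $\xi_1,\xi_2,\ldots$ be independent centered (not necessarily identically distributed) random variables such that $$\mathbf{E}\exp(\lambda\xi_k)\le\exp(\phi_k(\lambda)),\qquad |\lambda|<\lambda_0,\quad k=1,2,\ldots$$ Define $$\kappa(\lambda)=\sup_{n\ge1}\ \sup_{(a_1,\ldots,a_n)\in D(n)}\ \sum_{k=1}^n\phi_k(a_k\lambda),\qquad|\lambda|<\lambda_0,$$ and assume that $\kappa\in\Phi$. Then $$\sup_{n\ge1}\ \sup_{(a_1,\ldots,a_n)\in D(n)}\ \Big\|\sum_{k=1}^n a_k\xi_k\Big\|_{B(\kappa)}\le1 .$$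
   Context: All random variables are real-valued and defined on a common probability space. For $n\ge1$, $D(n)=\{(a_1,\ldots,a_n)\in\mathbb{R}^n:\ \sum_{k=1}^n a_k^2=1\}$. $\Phi$ is the set of all even, twice continuously differentiable, convex functions $\phi:(-\lambda_0,\lambda_0)\to\mathbb{R}$, where $\lambda_0\in(0,\infty]$, that are strictly increasing on $[0,\lambda_0)$, satisfy $\phi(\lambda)\asymp\lambda^2$ as $\lambda\to0$ (two-sided bounds by positive constants times $\lambda^2$), and, if $\lambda_0=\infty$, satisfy $\phi(\lambda)/\lambda\to\infty$ as $\lambda\to\infty$. For $\phi\in\Phi$, a random variable $\zeta$ belongs to $B(\phi)$ if there is a finite $\tau\ge0$ with $\mathbf{E}\exp(\lambda\zeta)\le\exp(\phi(\lambda\tau))$ for all $|\lambda|<\lambda_0$, where $\phi$ is read as $+\infty$ outside $(-\lambda_0,\lambda_0)$. The minimal such $\tau$ is the norm $\|\zeta\|_{B(\phi)}$. *)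

theory Defs
  imports "HOL-Probability.Probability"
begin

text \<open>Functions on \<open>(-l0, l0)\<close>, \<open>l0 \<in> (0, \<infinity>]\<close>, are represented by total functions
  whose values outside \<open>sym_interval l0\<close> are irrelevant.\<close>

definition sym_interval :: "ereal \<Rightarrow> real set" where
  "sym_interval l0 = {x. ereal \<bar>x\<bar> < l0}"

definition Phi :: "ereal \<Rightarrow> (real \<Rightarrow> real) set" where
  "Phi l0 = {\<phi>. 0 < l0
     \<and> (\<forall>x\<in>sym_interval l0. \<phi> (- x) = \<phi> x)
     \<and> (\<exists>\<phi>' \<phi>''. (\<forall>x\<in>sym_interval l0. (\<phi> has_real_derivative \<phi>' x) (at x)
                    \<and> (\<phi>' has_real_derivative \<phi>'' x) (at x))
                 \<and> continuous_on (sym_interval l0) \<phi>'')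
     \<and> convex_on (sym_interval l0) \<phi>
     \<and> strict_mono_on {x\<in>sym_interval l0. 0 \<le> x} \<phi>
     \<and> (\<exists>c>0. \<exists>C>0. \<forall>\<^sub>F x in at 0. c * x\<^sup>2 \<le> \<phi> x \<and> \<phi> x \<le> C * x\<^sup>2)
     \<and> (l0 = \<infinity> \<longrightarrow> filterlim (\<lambda>x. \<phi> x / x) at_top at_top)}"

text \<open>\<open>exp (\<phi> x)\<close> with \<open>\<phi>\<close> read as \<open>+\<infinity>\<close> outside \<open>(-l0, l0)\<close>.\<close>

definition exp_ext :: "ereal \<Rightarrow> (real \<Rightarrow> real) \<Rightarrow> real \<Rightarrow> ennreal" where
  "exp_ext l0 \<phi> x = (if x \<in> sym_interval l0 then ennreal (exp (\<phi> x)) else \<infinity>)"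

text \<open>Exponential moments are taken as nonnegative integrals, so that a divergent moment
  has the value \<open>\<infinity>\<close>.\<close>

definition exp_moment :: "'a measure \<Rightarrow> ('a \<Rightarrow> real) \<Rightarrow> real \<Rightarrow> ennreal" where
  "exp_moment M \<zeta> l = (\<integral>\<^sup>+ \<omega>. ennreal (exp (l * \<zeta> \<omega>)) \<partial>M)"

definition B_scales :: "'a measure \<Rightarrow> ereal \<Rightarrow> (real \<Rightarrow> real) \<Rightarrow> ('a \<Rightarrow> real) \<Rightarrow> real set" where
  "B_scales M l0 \<phi> \<zeta> =
     {\<tau>. 0 \<le> \<tau> \<and> (\<forall>l\<in>sym_interval l0. exp_moment M \<zeta> l \<le> exp_ext l0 \<phi> (l * \<tau>))}"

text \<open>The norm has the value \<open>\<infinity>\<close> exactly for the variables outside \<open>B(\<phi>)\<close>, that is,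
  those without an admissible scale; otherwise the infimum is a minimum, see
  \<open>B_norm_attained\<close> below.\<close>

definition B_norm :: "'a measure \<Rightarrow> ereal \<Rightarrow> (real \<Rightarrow> real) \<Rightarrow> ('a \<Rightarrow> real) \<Rightarrow> ennreal" where
  "B_norm M l0 \<phi> \<zeta> = (INF \<tau>\<in>B_scales M l0 \<phi> \<zeta>. ennreal \<tau>)"

text \<open>Vectors of \<open>\<real>\<^sup>n\<close> are the extensional functions on \<open>{1..n}\<close>.\<close>

definition D :: "nat \<Rightarrow> (nat \<Rightarrow> real) set" where
  "D n = {a \<in> {1..n} \<rightarrow>\<^sub>E UNIV. (\<Sum>k=1..n. (a k)\<^sup>2) = 1}"

lemma B_norm_attained:
  assumes phi: "\<phi> \<in> Phi l0" and ne: "B_scales M l0 \<phi> \<zeta> \<noteq> {}"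
  shows "\<exists>\<tau>\<in>B_scales M l0 \<phi> \<zeta>. (\<forall>\<sigma>\<in>B_scales M l0 \<phi> \<zeta>. \<tau> \<le> \<sigma>) \<and> B_norm M l0 \<phi> \<zeta> = ennreal \<tau>"
proof -
  let ?S = "B_scales M l0 \<phi> \<zeta>"
  have bdd: "bdd_below ?S"
    by (rule bdd_belowI[of _ 0]) (auto simp: B_scales_def)
  have "closed ?S"
    unfolding closed_sequential_limits
  proof (intro allI impI, elim conjE)
    fix t \<tau> assume t: "\<forall>n. t n \<in> ?S" and lim: "t \<longlonglongrightarrow> \<tau>"
    have "0 \<le> \<tau>"
      using t lim by (intro LIMSEQ_le_const[OF lim]) (auto simp: B_scales_def)
    moreover have "exp_moment M \<zeta> l \<le> exp_ext l0 \<phi> (l * \<tau>)" if l: "l \<in> sym_interval l0" for l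
    proof (cases "l * \<tau> \<in> sym_interval l0")
      case True
      have lim': "(\<lambda>n. l * t n) \<longlonglongrightarrow> l * \<tau>" using lim by (intro tendsto_intros)
      have "isCont \<phi> (l * \<tau>)"
        using phi True unfolding Phi_def by (auto intro: DERIV_isCont)
      then have lim_exp: "(\<lambda>n. ennreal (exp (\<phi> (l * t n)))) \<longlonglongrightarrow> ennreal (exp (\<phi> (l * \<tau>)))"
        using lim' by (intro tendsto_ennrealI tendsto_exp isCont_tendsto_compose[of _ \<phi>])
      have "(\<lambda>n. ereal \<bar>l * t n\<bar>) \<longlonglongrightarrow> ereal \<bar>l * \<tau>\<bar>"
        using lim' by (intro tendsto_ereal tendsto_rabs)
      then have "\<forall>\<^sub>F n in sequentially. ereal \<bar>l * t n\<bar> < l0"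
        using True by (intro order_tendstoD(2)) (auto simp: sym_interval_def)
      then have "\<forall>\<^sub>F n in sequentially. exp_moment M \<zeta> l \<le> ennreal (exp (\<phi> (l * t n)))"
      proof eventually_elim
        case (elim n)
        have "exp_moment M \<zeta> l \<le> exp_ext l0 \<phi> (l * t n)"
          using t l by (auto simp: B_scales_def)
        then show ?case using elim by (simp add: exp_ext_def sym_interval_def)
      qed
      then have "exp_moment M \<zeta> l \<le> ennreal (exp (\<phi> (l * \<tau>)))"
        by (intro tendsto_lowerbound[OF lim_exp]) auto
      then show ?thesis using True by (simp add: exp_ext_def)
    qed (simp add: exp_ext_def)
    ultimately show "\<tau> \<in> ?S" by (simp add: B_scales_def)
  qed
  then have mem: "Inf ?S \<in> ?S"
    using ne bdd by (intro closed_contains_Inf)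
  have le: "\<forall>\<sigma>\<in>?S. Inf ?S \<le> \<sigma>" using bdd by (auto intro: cInf_lower)
  have "B_norm M l0 \<phi> \<zeta> = ennreal (Inf ?S)"
    unfolding B_norm_def
  proof (rule antisym)
    show "(INF \<tau>\<in>?S. ennreal \<tau>) \<le> ennreal (Inf ?S)" using mem by (rule INF_lower)
    show "ennreal (Inf ?S) \<le> (INF \<tau>\<in>?S. ennreal \<tau>)"
      using le by (intro INF_greatest) (auto intro: ennreal_leI)
  qed
  then show ?thesis using mem le by blast
qed

end

theory Submission
  imports Defs
begin

text \<open>By independence, the exponential moment of \<open>\<Sum>k=1..n. a k * \<xi> k\<close> at
  \<open>l\<close> is the product of the moments of \<open>\<xi> k\<close> at
  \<open>a k * l\<close>. A unit vector has entries of modulus at most 1, so each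
  \<open>a k * l\<close> stays in the interval and the assumed bounds apply. Their product is the
  exponential of \<open>\<Sum>k=1..n. \<phi> k (a k * l)\<close>, one of the sums whose supremum is
  \<open>\<kappa> l\<close>. Hence 1 is an admissible scale
  (\<open>exp_moment_linear_combination_le\<close> carries the estimate), and the norm, an infimum
  of such scales, is at most 1.\<close>

lemma sym_interval_mult:
  assumes "l \<in> sym_interval l0" and "\<bar>c\<bar> \<le> 1"
  shows "c * l \<in> sym_interval l0"
proof -
  have "\<bar>c * l\<bar> \<le> \<bar>l\<bar>"
    using assms(2) by (simp add: abs_mult mult_left_le_one_le)
  then have "ereal \<bar>c * l\<bar> \<le> ereal \<bar>l\<bar>"
    by simp
  then show ?thesis
    using assms(1) unfolding sym_interval_def mem_Collect_eq by (rule le_less_trans)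
qed

lemma D_abs_le_1:
  assumes "a \<in> D n" and "k \<in> {1..n}"
  shows "\<bar>a k\<bar> \<le> 1"
proof -
  have "(a k)\<^sup>2 \<le> (\<Sum>j=1..n. (a j)\<^sup>2)"
    using assms(2) by (intro member_le_sum) auto
  then show ?thesis
    using assms(1) by (simp add: D_def abs_square_le_1)
qed

lemma exp_moment_scale: "exp_moment M (\<lambda>\<omega>. c * X \<omega>) l = exp_moment M X (c * l)"
  by (simp add: exp_moment_def mult_ac)

text \<open>The exponential turns the sum into a product of independent factors. The product formula
  is applied to nonnegative integrals, so it also covers infinite moments.\<close>

lemma (in prob_space) exp_moment_sum:
  assumes "finite I" and "indep_vars (\<lambda>_. borel) X I"
  shows "exp_moment M (\<lambda>\<omega>. \<Sum>i\<in>I. X i \<omega>) l = (\<Prod>i\<in>I. exp_moment M (X i) l)"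
proof -
  have "indep_vars (\<lambda>_. borel) (\<lambda>i \<omega>. ennreal (exp (l * X i \<omega>))) I"
    by (rule indep_vars_compose2[OF assms(2)]) measurable
  then have "(\<integral>\<^sup>+\<omega>. (\<Prod>i\<in>I. ennreal (exp (l * X i \<omega>))) \<partial>M) = (\<Prod>i\<in>I. exp_moment M (X i) l)"
    unfolding exp_moment_def by (intro indep_vars_nn_integral assms(1)) auto
  then show ?thesis
    using assms(1) by (simp add: exp_moment_def sum_distrib_left exp_sum prod_ennreal)
qed

text \<open>Each coefficient moves into the argument of the moment, so a bound at the single point
  \<open>a i * l\<close> suffices for each \<open>i\<close>; keeping that point in the domain is
  left to the caller.\<close>

lemma (in prob_space) exp_moment_linear_combination_le:
  assumes "finite I" and "indep_vars (\<lambda>_. borel) X I"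
    and "\<And>i. i \<in> I \<Longrightarrow> exp_moment M (X i) (a i * l) \<le> ennreal (exp (f i))"
  shows "exp_moment M (\<lambda>\<omega>. \<Sum>i\<in>I. a i * X i \<omega>) l \<le> ennreal (exp (\<Sum>i\<in>I. f i))"
proof -
  have "indep_vars (\<lambda>_. borel) (\<lambda>i \<omega>. a i * X i \<omega>) I"
    by (rule indep_vars_compose2[OF assms(2)]) measurable
  then have "exp_moment M (\<lambda>\<omega>. \<Sum>i\<in>I. a i * X i \<omega>) l = (\<Prod>i\<in>I. exp_moment M (X i) (a i * l))"
    by (simp add: exp_moment_sum assms(1) exp_moment_scale)
  also have "\<dots> \<le> (\<Prod>i\<in>I. ennreal (exp (f i)))"
    using assms(3) by (intro prod_mono_ennreal) auto
  also have "\<dots> = ennreal (exp (\<Sum>i\<in>I. f i))"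
    using assms(1) by (simp add: exp_sum prod_ennreal)
  finally show ?thesis .
qed

theorem theorem4p1:
  fixes M :: "'a measure" and l0 :: ereal and \<phi> :: "nat \<Rightarrow> real \<Rightarrow> real"
    and \<xi> :: "nat \<Rightarrow> 'a \<Rightarrow> real" and \<kappa> :: "real \<Rightarrow> real"
  assumes "prob_space M"
    and "0 < l0"
    and "\<And>k. k \<ge> 1 \<Longrightarrow> \<phi> k \<in> Phi l0"
    and "prob_space.indep_vars M (\<lambda>_. borel) \<xi> {1..}"
    and "\<And>k. k \<ge> 1 \<Longrightarrow> integrable M (\<xi> k) \<and> integral\<^sup>L M (\<xi> k) = 0"
    and "\<And>k l. k \<ge> 1 \<Longrightarrow> l \<in> sym_interval l0 \<Longrightarrow> exp_moment M (\<xi> k) l \<le> ennreal (exp (\<phi> k l))"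
    and "\<And>l. l \<in> sym_interval l0 \<Longrightarrow>
           ereal (\<kappa> l) = (SUP n\<in>{1..}. SUP a\<in>D n. ereal (\<Sum>k=1..n. \<phi> k (a k * l)))"
    and "\<kappa> \<in> Phi l0"
  shows "(SUP n\<in>{1..}. SUP a\<in>D n. B_norm M l0 \<kappa> (\<lambda>\<omega>. \<Sum>k=1..n. a k * \<xi> k \<omega>)) \<le> 1"
proof (intro SUP_least)
  interpret prob_space M by fact
  fix n a assume n: "n \<in> {1::nat..}" and a: "a \<in> D n"
  let ?S = "\<lambda>\<omega>. \<Sum>k=1..n. a k * \<xi> k \<omega>"
  \<comment> \<open>The factor 1 is the candidate scale; as \<open>l * 1\<close> lies in the
    interval, \<open>exp_ext\<close> takes its finite value.\<close>
  have "exp_moment M ?S l \<le> exp_ext l0 \<kappa> (l * 1)" if l: "l \<in> sym_interval l0" for l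
  proof -
    have indep: "indep_vars (\<lambda>_. borel) \<xi> {1..n}"
      by (rule indep_vars_subset[OF assms(4)]) auto
    have "exp_moment M ?S l \<le> ennreal (exp (\<Sum>k=1..n. \<phi> k (a k * l)))"
    proof (rule exp_moment_linear_combination_le[OF _ indep])
      fix k assume k: "k \<in> {1..n}"
      then show "exp_moment M (\<xi> k) (a k * l) \<le> ennreal (exp (\<phi> k (a k * l)))"
        using sym_interval_mult[OF l D_abs_le_1[OF a k]] by (intro assms(6)) auto
    qed simp
    \<comment> \<open>The given \<open>n\<close> and \<open>a\<close> compete in the supremum
      defining \<open>\<kappa> l\<close>. This comparison in \<open>ereal\<close> only feeds the
      next inequality, which is the link that continues the chain.\<close>
    also have "ereal (\<Sum>k=1..n. \<phi> k (a k * l)) \<le> ereal (\<kappa> l)"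
      unfolding assms(7)[OF l] using n a by (intro SUP_upper2[of n] SUP_upper2[of a]) auto
    then have "ennreal (exp (\<Sum>k=1..n. \<phi> k (a k * l))) \<le> ennreal (exp (\<kappa> l))"
      by (intro ennreal_leI) simp
    finally show ?thesis
      using l by (simp add: exp_ext_def)
  qed
  then have "1 \<in> B_scales M l0 \<kappa> ?S"
    by (simp add: B_scales_def)
  then have "B_norm M l0 \<kappa> ?S \<le> ennreal 1"
    unfolding B_norm_def by (rule INF_lower)
  then show "B_norm M l0 \<kappa> ?S \<le> 1"
    by simp
qed

end
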